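(* Let $d$ be a positive integer and $P$ be a real polynomial. Then $P$ belongs to $\mathscr{E}_d$ if and only if $A_P$ is a multiple (in $\mathbb{R}[X]$) of the polynomial $1 + X + X^2 + \dots + X^{d-1}$.
   Context: Here $\mathbb{N} = \{0, 1, 2, \dots\}$. For a positive integer $d$, $\mathscr{E}_d$ denotes the set (an $\mathbb{R}$-linear subspace of $\mathbb{R}[X]$) of all polynomials $P \in \mathbb{R}[X]$ for which the sum $P(n) + P(n-d) + P(n-2d) + \cdots := \sum_{0 \leq k \leq n/d} P(n - k d)$ (the sum over integers $k \ge 0$ with $n - kd \geq 0$) is polynomial in $n \in \mathbb{N}$, i.e. there exists $S \in \mathbb{R}[X]$ such that this sum equals $S(n)$ for all $n \in \mathbb{N}$. For $P \in \mathbb{R}[X]$, $A_P \in \mathbb{R}[X]$ denotes the unique polynomial satisfying the identity of formal power series $$\sum_{n=0}^{+\infty} P(n) X^n = \frac{A_P(X)}{(1 - X)^{\deg P + 1}}$$ (with $A_P = 0$ if $P = 0$). It is a well-known fact that such a polynomial exists, and that if $P \neq 0$ then $A_P(1) \neq 0$ and $\deg A_P \leq \deg P$. *)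

theory Defs
  imports Complex_Main "HOL-Computational_Algebra.Computational_Algebra"
begin

text \<open>The condition \<open>0 \<le> k \<le> n / d\<close> on an integer \<open>k\<close> is \<open>k \<le> n div d\<close>. The definition is only
  meant for \<open>d > 0\<close>.\<close>

definition E_set :: "nat \<Rightarrow> real poly set" where
  "E_set d = {P. \<exists>S :: real poly. \<forall>n :: nat.
     (\<Sum>k\<le>n div d. poly P (real n - real k * real d)) = poly S (real n)}"

text \<open>Since \<open>degree 0 = 0\<close>, the defining identity also gives \<open>A_poly 0 = 0\<close>.\<close>

definition A_poly :: "real poly \<Rightarrow> real poly" where
  "A_poly P = (THE A. Abs_fps (\<lambda>n. poly P (real n)) =
     fps_of_poly A / (1 - fps_X) ^ (degree P + 1))"

lemma degree_backward_difference:
  fixes P :: "real poly"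
  assumes "degree P \<le> m"
  shows "P - pcompose P [:-1, 1:] = 0 \<or> degree (P - pcompose P [:-1, 1:]) < m"
proof -
  let ?Q = "P - pcompose P [:-1, 1:]"
  have dc: "degree (pcompose P [:-1, 1:]) = degree P" by (simp add: degree_pcompose)
  have "lead_coeff (pcompose P [:-1, 1:]) = lead_coeff P"
    by (subst lead_coeff_comp) auto
  then have "coeff ?Q (degree P) = 0" using dc by simp
  moreover have "degree ?Q \<le> degree P"
    using degree_diff_le[of P "degree P" "pcompose P [:-1, 1:]"] dc by simp
  ultimately have "?Q = 0 \<or> degree ?Q < degree P"
    by (metis leading_coeff_0_iff le_neq_implies_less)
  with assms show ?thesis by linarith
qed

lemma A_poly_exists_aux:
  "P = 0 \<or> degree P < m \<Longrightarrow>
   \<exists>A :: real poly. Abs_fps (\<lambda>n. poly P (real n)) * (1 - fps_X) ^ m = fps_of_poly A"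
proof (induction m arbitrary: P)
  case 0
  then have "Abs_fps (\<lambda>n. poly P (real n)) * (1 - fps_X) ^ 0 = fps_of_poly 0"
    by (simp add: fps_eq_iff)
  then show ?case by blast
next
  case (Suc m)
  let ?Q = "P - pcompose P [:-1, 1:]"
  have "degree P \<le> m" using Suc.prems by auto
  from Suc.IH[OF degree_backward_difference[OF this]] obtain A where
    A: "Abs_fps (\<lambda>n. poly ?Q (real n)) * (1 - fps_X) ^ m = fps_of_poly A" by blast
  have step: "Abs_fps (\<lambda>n. poly P (real n)) * (1 - fps_X) =
      Abs_fps (\<lambda>n. poly ?Q (real n)) + fps_const (poly P (-1))"
  proof (rule fps_ext)
    fix n
    show "fps_nth (Abs_fps (\<lambda>n. poly P (real n)) * (1 - fps_X)) n =
      fps_nth (Abs_fps (\<lambda>n. poly ?Q (real n)) + fps_const (poly P (-1))) n"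
      by (cases n) (auto simp: right_diff_distrib poly_pcompose)
  qed
  have X: "(1 - fps_X :: real fps) = fps_of_poly [:1, -1:]"
    by (simp add: fps_of_poly_pCons fps_const_neg [symmetric])
  have "Abs_fps (\<lambda>n. poly P (real n)) * (1 - fps_X) ^ Suc m =
    (Abs_fps (\<lambda>n. poly P (real n)) * (1 - fps_X)) * (1 - fps_X) ^ m"
    by (simp add: mult.assoc)
  also have "\<dots> = fps_of_poly (A + [:poly P (-1):] * [:1, -1:] ^ m)"
    unfolding step distrib_right A
    by (simp only: fps_of_poly_add fps_of_poly_mult fps_of_poly_power X fps_of_poly_const)
  finally show ?case by blast
qed

theorem A_poly_ex1:
  "\<exists>!A. Abs_fps (\<lambda>n. poly P (real n)) = fps_of_poly A / (1 - fps_X) ^ (degree P + 1)"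
proof -
  let ?D = "(1 - fps_X :: real fps) ^ (degree P + 1)"
  have unit: "fps_nth ?D 0 \<noteq> 0" by (simp add: fps_nth_power_0)
  have iff: "F = G / ?D \<longleftrightarrow> F * ?D = G" for F G :: "real fps"
  proof -
    let ?I = "inverse ?D"
    have 1: "?D * ?I = 1"
      using inverse_mult_eq_1'[OF unit] .
    have 2: "?I * ?D = 1"
      using inverse_mult_eq_1[OF unit] .
    have "G * ?I * ?D = G" "F * ?D * ?I = F"
      by (simp_all only: mult.assoc 1 2 mult_1_right)
    then show ?thesis
      unfolding fps_divide_unit[OF unit] by metis
  qed
  obtain A where "Abs_fps (\<lambda>n. poly P (real n)) * ?D = fps_of_poly A"
    using A_poly_exists_aux[of P "degree P + 1"] by auto
  then show ?thesis
    unfolding iff by (auto simp: fps_of_poly_eq_iff)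
qed

end

theory Submission
  imports Defs "HOL-Computational_Algebra.Field_as_Ring"
begin

text \<open>Let \<open>F\<close> be the generating function of the sums \<open>P(n) + P(n-d) + \<dots>\<close> and
  \<open>\<Phi> = 1 + X + \<dots> + X\<^sup>d\<^sup>-\<^sup>1\<close>. Since \<open>F (1 - X\<^sup>d)\<close> is the generating function of \<open>P\<close> and
  \<open>1 - X\<^sup>d = (1 - X) \<Phi>\<close>, we get \<open>F \<Phi> (1 - X)\<^bsup>deg P + 2\<^esup> = A\<^sub>P\<close>. A power series has polynomial
  coefficients iff it is of the form \<open>B / (1 - X)\<^sup>m\<close> with \<open>deg B < m\<close>. If \<open>F\<close> is of this form, then
  \<open>\<Phi>\<close> divides \<open>A\<^sub>P\<close> times a power of \<open>1 - X\<close>, hence \<open>A\<^sub>P\<close>, because \<open>\<Phi>(1) = d \<noteq> 0\<close>. Conversely, if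
  \<open>A\<^sub>P = \<Phi> B\<close>, then \<open>F = B / (1 - X)\<^bsup>deg P + 2\<^esup>\<close> and \<open>deg B \<le> deg A\<^sub>P \<le> deg P\<close>.\<close>

lemma fps_of_poly_one_minus_X: "fps_of_poly [:1, -1:] = (1 - fps_X :: real fps)"
  by (simp add: fps_of_poly_pCons fps_const_neg [symmetric])

lemma one_minus_fps_X_power_neq_0: "(1 - fps_X :: real fps) ^ m \<noteq> 0"
proof -
  have "fps_nth ((1 - fps_X :: real fps) ^ m) 0 \<noteq> 0"
    by (simp add: fps_nth_power_0)
  then show ?thesis by (metis fps_zero_nth)
qed

text \<open>Multiplying by 1 - X takes backward differences of the coefficients, so Pascal's rule
  lowers \<open>m\<close> by one.\<close>

lemma fps_binomial_mult_power:
  "Abs_fps (\<lambda>n. real ((n + m) choose m)) * (1 - fps_X) ^ Suc m = 1"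
proof (induction m)
  case 0
  show ?case
  proof (rule fps_ext)
    fix n
    show "fps_nth (Abs_fps (\<lambda>n. real ((n + 0) choose 0)) * (1 - fps_X) ^ Suc 0) n = fps_nth 1 n"
      by (cases n) (auto simp: right_diff_distrib)
  qed
next
  case (Suc m)
  have "Abs_fps (\<lambda>n. real ((n + Suc m) choose Suc m)) * (1 - fps_X) =
    Abs_fps (\<lambda>n. real ((n + m) choose m))"
  proof (rule fps_ext)
    fix n
    show "fps_nth (Abs_fps (\<lambda>n. real ((n + Suc m) choose Suc m)) * (1 - fps_X)) n =
      fps_nth (Abs_fps (\<lambda>n. real ((n + m) choose m))) n"
      by (cases n) (auto simp: right_diff_distrib)
  qed
  with Suc.IH show ?case
    by (simp only: power_Suc mult.assoc [symmetric])
qed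

lemma binomial_eq_poly: "\<exists>R :: real poly. \<forall>n. real ((n + m) choose m) = poly R (real n)"
proof (intro exI allI)
  fix n
  have "real ((n + m) choose m) = (\<Prod>i<m. real n + (real m - real i)) / fact m"
    by (simp add: binomial_gbinomial gbinomial_prod_rev atLeast0LessThan algebra_simps)
  also have "\<dots> = poly (smult (1 / fact m) (\<Prod>i<m. [:real m - real i, 1:])) (real n)"
    by (simp add: poly_prod algebra_simps)
  finally show "real ((n + m) choose m) =
    poly (smult (1 / fact m) (\<Prod>i<m. [:real m - real i, 1:])) (real n)" .
qed

text \<open>Converse of \<open>A_poly_exists_aux\<close>, by partial fractions with the only pole at
  1: splitting \<open>B\<close> as a constant plus a multiple of 1 - X lowers the order of the pole
  by one, and the constant contributes a multiple of a binomial sequence, which is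
  polynomial.\<close>

lemma proper_fraction_poly_coeffs:
  fixes B :: "real poly"
  assumes "B = 0 \<or> degree B < m"
  shows "\<exists>Q :: real poly. Abs_fps (\<lambda>n. poly Q (real n)) * (1 - fps_X) ^ m = fps_of_poly B"
  using assms
proof (induction m arbitrary: B)
  case 0
  then have "Abs_fps (\<lambda>n. poly 0 (real n)) * (1 - fps_X) ^ 0 = fps_of_poly B"
    by (simp add: fps_eq_iff)
  then show ?case by blast
next
  case (Suc m)
  \<comment> \<open>The value at 1 is the one constant that leaves a remainder divisible by 1 -
    X.\<close>
  define c where "c = poly B 1"
  have "poly (B - [:c:]) 1 = 0" by (simp add: c_def)
  then obtain C where "B - [:c:] = [:-1, 1:] * C"
    using poly_eq_0_iff_dvd by (metis dvdE)
  then have C: "B - [:c:] = [:1, -1:] * (- C)" by simp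
  have "degree B \<le> m" using Suc.prems by auto
  then have "degree (B - [:c:]) \<le> m" by (intro degree_diff_le) auto
  moreover have "degree (B - [:c:]) = Suc (degree (- C))" if "- C \<noteq> 0"
    unfolding C using that by (subst degree_mult_eq) auto
  ultimately have "- C = 0 \<or> degree (- C) < m" by fastforce
  from Suc.IH[OF this] obtain Q where
    Q: "Abs_fps (\<lambda>n. poly Q (real n)) * (1 - fps_X) ^ m = fps_of_poly (- C)" by blast
  obtain R :: "real poly" where R: "\<And>n. real ((n + m) choose m) = poly R (real n)"
    using binomial_eq_poly by blast
  have split: "Abs_fps (\<lambda>n. poly (Q + smult c R) (real n)) =
    Abs_fps (\<lambda>n. poly Q (real n)) + fps_const c * Abs_fps (\<lambda>n. real ((n + m) choose m))"
    by (rule fps_ext) (simp add: R)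
  have "Abs_fps (\<lambda>n. poly (Q + smult c R) (real n)) * (1 - fps_X) ^ Suc m =
    (1 - fps_X) * (Abs_fps (\<lambda>n. poly Q (real n)) * (1 - fps_X) ^ m) +
    fps_const c * (Abs_fps (\<lambda>n. real ((n + m) choose m)) * (1 - fps_X) ^ Suc m)"
    unfolding split by (simp add: algebra_simps)
  also have "\<dots> = fps_of_poly ([:1, -1:] * (- C) + [:c:])"
    unfolding Q fps_binomial_mult_power fps_of_poly_add fps_of_poly_mult fps_of_poly_one_minus_X
      fps_of_poly_const by simp
  also have "\<dots> = fps_of_poly B" unfolding C [symmetric] by simp
  finally show ?case by blast
qed

text \<open>Otherwise the nonzero polynomial P - Q would have infinitely many roots.\<close>

lemma poly_eq_if_eventually_eq_nat:
  fixes P Q :: "real poly"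
  assumes "\<And>n. n > N \<Longrightarrow> poly P (real n) = poly Q (real n)"
  shows "P = Q"
proof (rule ccontr)
  assume "P \<noteq> Q"
  then have "finite {x. poly (P - Q) x = 0}" by (intro poly_roots_finite) simp
  moreover have "real ` {N<..} \<subseteq> {x. poly (P - Q) x = 0}" using assms by auto
  ultimately have "finite (real ` {N<..})" by (rule finite_subset[rotated])
  then have "finite {N<..}" by (rule finite_imageD) (auto simp: inj_on_def)
  then show False using infinite_Ioi by blast
qed

lemma A_poly_eq:
  "Abs_fps (\<lambda>n. poly P (real n)) * (1 - fps_X) ^ (degree P + 1) = fps_of_poly (A_poly P)"
proof -
  let ?D = "(1 - fps_X :: real fps) ^ (degree P + 1)"
  have unit: "fps_nth ?D 0 \<noteq> 0" by (simp add: fps_nth_power_0)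
  have "Abs_fps (\<lambda>n. poly P (real n)) = fps_of_poly (A_poly P) / ?D"
    unfolding A_poly_def by (rule theI'[OF A_poly_ex1])
  then have "Abs_fps (\<lambda>n. poly P (real n)) = fps_of_poly (A_poly P) * inverse ?D"
    by (simp only: fps_divide_unit[OF unit])
  then show ?thesis
    by (simp only: mult.assoc inverse_mult_eq_1[OF unit] mult_1_right)
qed

text \<open>The polynomial part of \<open>A\<^sub>P / (1 - X)\<^bsup>deg P + 1\<^esup>\<close> vanishes: it only affects finitely many
  coefficients, and two polynomial sequences that agree eventually are equal.\<close>

lemma degree_A_poly: "degree (A_poly P) \<le> degree P"
proof -
  let ?m = "degree P + 1" and ?q = "[:1, -1:] :: real poly"
  \<comment> \<open>Division with remainder splits the fraction into its polynomial part
    \<open>D\<close> and a proper fraction with numerator \<open>C\<close>.\<close>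
  define C where "C = A_poly P mod ?q ^ ?m"
  define D where "D = A_poly P div ?q ^ ?m"
  have AC: "A_poly P = D * ?q ^ ?m + C" by (simp only: C_def D_def div_mult_mod_eq)
  have "?q ^ ?m \<noteq> 0" by (rule power_not_zero) simp
  from degree_mod_less[OF this, of "A_poly P"] have degC: "C = 0 \<or> degree C < ?m"
    unfolding C_def by (simp add: degree_power_eq del: Suc_eq_plus1 add_Suc_right One_nat_def)
  then obtain Q where
    Q: "Abs_fps (\<lambda>n. poly Q (real n)) * (1 - fps_X) ^ ?m = fps_of_poly C"
    using proper_fraction_poly_coeffs by blast
  have "Abs_fps (\<lambda>n. poly P (real n)) * (1 - fps_X) ^ ?m =
      (fps_of_poly D + Abs_fps (\<lambda>n. poly Q (real n))) * (1 - fps_X) ^ ?m"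
    unfolding A_poly_eq distrib_right Q unfolding AC
    by (simp only: fps_of_poly_add fps_of_poly_mult fps_of_poly_power fps_of_poly_one_minus_X)
  then have E: "Abs_fps (\<lambda>n. poly P (real n)) = fps_of_poly D + Abs_fps (\<lambda>n. poly Q (real n))"
    using one_minus_fps_X_power_neq_0 mult_right_cancel by blast
  have coeffs: "poly P (real n) = coeff D n + poly Q (real n)" for n
    using arg_cong[OF E, of "\<lambda>F. fps_nth F n"] by simp
  have "P = Q"
    by (rule poly_eq_if_eventually_eq_nat[of "degree D"]) (simp add: coeffs coeff_eq_0)
  with coeffs have "D = 0" by (simp add: poly_eq_iff)
  with AC degC show ?thesis by auto
qed

lemma one_minus_X_mult_sum:
  "[:1, -1:] * (\<Sum>k<d. monom 1 k) = 1 - monom (1 :: real) d"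
proof (induction d)
  case (Suc d)
  then show ?case by (simp add: distrib_left monom_Suc algebra_simps)
qed simp

text \<open>The sum at n - d consists of the terms k > 0 of the sum at n, so the difference leaves
  only k = 0. For n < d there is no other term.\<close>

lemma fps_step_sum:
  fixes f :: "nat \<Rightarrow> real"
  assumes "d > 0"
  shows "Abs_fps (\<lambda>n. \<Sum>k\<le>n div d. f (n - k * d)) * (1 - fps_X ^ d) = Abs_fps f"
proof (rule fps_ext)
  fix n
  show "fps_nth (Abs_fps (\<lambda>n. \<Sum>k\<le>n div d. f (n - k * d)) * (1 - fps_X ^ d)) n =
    fps_nth (Abs_fps f) n"
  proof (cases "n < d")
    case True
    then show ?thesis by (simp add: right_diff_distrib fps_X_power_mult_right_nth)
  next
    case False
    then have "n div d = Suc ((n - d) div d)"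
      using assms by (simp add: le_div_geq)
    with False show ?thesis
      by (simp add: right_diff_distrib fps_X_power_mult_right_nth sum.atMost_Suc_shift
          del: sum.atMost_Suc)
  qed
qed

theorem proposition2p8:
  fixes d :: nat and P :: "real poly"
  assumes "d > 0"
  shows "P \<in> E_set d \<longleftrightarrow> (\<Sum>k<d. monom 1 k) dvd A_poly P"
proof -
  let ?q = "[:1, -1:] :: real poly" and ?p = "degree P"
  define \<Phi> :: "real poly" where "\<Phi> = (\<Sum>k<d. monom 1 k)"
  define F where "F = Abs_fps (\<lambda>n. \<Sum>k\<le>n div d. poly P (real n - real k * real d))"
  \<comment> \<open>Within the range of summation k d \<le> n, so truncated subtraction agrees with
    real subtraction.\<close>
  have "F = Abs_fps (\<lambda>n. \<Sum>k\<le>n div d. poly P (real (n - k * d)))"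
    unfolding F_def
  proof (intro fps_ext, simp, intro sum.cong refl)
    fix n k
    assume "k \<in> {..n div d}"
    then have "k * d \<le> n" using assms by (simp add: less_eq_div_iff_mult_less_eq)
    then show "poly P (real n - real k * real d) = poly P (real (n - k * d))"
      by (simp add: of_nat_diff)
  qed
  then have "F * (1 - fps_X ^ d) = Abs_fps (\<lambda>n. poly P (real n))"
    using fps_step_sum[OF assms, of "\<lambda>n. poly P (real n)"] by simp
  moreover have "(1 - fps_X ^ d :: real fps) = (1 - fps_X) * fps_of_poly \<Phi>"
    unfolding fps_of_poly_one_minus_X [symmetric] fps_of_poly_mult [symmetric] \<Phi>_def
      one_minus_X_mult_sum by (simp add: fps_of_poly_diff fps_of_poly_monom')
  ultimately have FP: "F * ((1 - fps_X) * fps_of_poly \<Phi>) = Abs_fps (\<lambda>n. poly P (real n))"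
    by simp
  \<comment> \<open>The exponent is deg P + 1 from the denominator belonging to
    \<open>A_poly P\<close>, plus one from the factor 1 - X of 1 - X^d.\<close>
  have FA: "F * (1 - fps_X) ^ (?p + 2) * fps_of_poly \<Phi> = fps_of_poly (A_poly P)"
    unfolding A_poly_eq [symmetric] FP [symmetric] by (simp add: mult_ac)
  have \<Phi>1: "poly \<Phi> 1 \<noteq> 0" using assms by (simp add: \<Phi>_def poly_sum poly_monom)
  have E_iff: "P \<in> E_set d \<longleftrightarrow> (\<exists>S. F = Abs_fps (\<lambda>n. poly S (real n)))"
    unfolding E_set_def F_def by (simp add: fps_eq_iff)
  show ?thesis
    unfolding \<Phi>_def [symmetric]
  proof
    assume "P \<in> E_set d"
    then obtain S where S: "F = Abs_fps (\<lambda>n. poly S (real n))" using E_iff by blast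
    define m where "m = Suc (degree S)"
    obtain C where C: "F * (1 - fps_X) ^ m = fps_of_poly C"
      unfolding S using A_poly_exists_aux[of S m] by (auto simp: m_def)
    \<comment> \<open>Both sides are F \<Phi> (1 - X)^(deg P + 2 + m), which brings the identity
      back from power series to polynomials.\<close>
    have "fps_of_poly (A_poly P * ?q ^ m) = fps_of_poly (C * ?q ^ (?p + 2) * \<Phi>)"
      unfolding fps_of_poly_mult fps_of_poly_power fps_of_poly_one_minus_X
        FA [symmetric] C [symmetric] by (simp only: mult_ac)
    then have "A_poly P * ?q ^ m = C * ?q ^ (?p + 2) * \<Phi>"
      unfolding fps_of_poly_eq_iff .
    then have dvd: "\<Phi> dvd A_poly P * ?q ^ m" by simp
    \<comment> \<open>The prime X - 1 does not divide \<Phi> since 1 is not a root; coprimality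
      survives the change of sign and the power.\<close>
    have "coprime [:-1, 1:] \<Phi>"
    proof (rule prime_elem_imp_coprime)
      show "prime_elem [:-1, 1 :: real:]"
        by (rule prime_elem_linear_field_poly) simp
      show "\<not> [:-1, 1:] dvd \<Phi>" using \<Phi>1 poly_eq_0_iff_dvd[of \<Phi> 1] by simp
    qed
    moreover have "?q = - [:-1, 1:]" by simp
    ultimately have "coprime \<Phi> (?q ^ m)"
      by (metis coprime_commute coprime_minus_left_iff coprime_power_right_iff)
    with dvd show "\<Phi> dvd A_poly P" by (simp add: coprime_dvd_mult_left_iff)
  next
    assume "\<Phi> dvd A_poly P"
    then obtain B where B: "A_poly P = \<Phi> * B" by blast
    have \<Phi>0: "\<Phi> \<noteq> 0" using \<Phi>1 by auto
    have "B = 0 \<or> degree B < ?p + 2"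
      using degree_A_poly[of P] \<Phi>0 unfolding B by (cases "B = 0") (auto simp: degree_mult_eq)
    then obtain S where S: "Abs_fps (\<lambda>n. poly S (real n)) * (1 - fps_X) ^ (?p + 2) = fps_of_poly B"
      using proper_fraction_poly_coeffs by blast
    \<comment> \<open>Both products are \<open>A_poly P\<close>, and power series over the reals
      have no zero divisors.\<close>
    have "F * (1 - fps_X) ^ (?p + 2) * fps_of_poly \<Phi> =
        Abs_fps (\<lambda>n. poly S (real n)) * (1 - fps_X) ^ (?p + 2) * fps_of_poly \<Phi>"
      unfolding FA S B by (simp add: fps_of_poly_mult mult.commute)
    moreover have "fps_of_poly \<Phi> \<noteq> 0" using \<Phi>0 by simp
    ultimately have "F = Abs_fps (\<lambda>n. poly S (real n))"
      using one_minus_fps_X_power_neq_0 mult_right_cancel by blast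
    then show "P \<in> E_set d" using E_iff by blast
  qed
qed

end
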